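(* Let $\mathbb K\in\{\mathbb R,\mathbb C\}$ and let $V=(\mathbb K^{\dim V},\langle\cdot,R_V\cdot\rangle)$ and $W=(\mathbb K^{\dim W},\langle\cdot,R_W\cdot\rangle)$ be finite-dimensional Hilbert spaces, where $R_V$, $R_W$ are self-adjoint positive definite matrices. Let $V_p\subset V$ and $W_q\subset W$ be subspaces, and let $\mathbf V_p\in\mathbb K^{\dim V\times p}$ and $\mathbf W_q\in\mathbb K^{\dim W\times q}$ be matrices whose columns span $V_p$ and $W_q$ respectively, with $\mathbf V_p^*R_V\mathbf V_p=I_p$ and $\mathbf W_q^*R_W\mathbf W_q=I_q$. Let $Q_{V_p}=\mathbf V_p^*R_V$ and $Q_{W_q}=\mathbf W_q^*R_W$ (so that $Q_{V_p}^*Q_{V_p}=R_V\Pi_{V_p}$ and $Q_{W_q}^*Q_{W_q}=R_W\Pi_{W_q}$). If $\Upsilon$ is a $(\varepsilon,\delta,d)$ oblivious $\mathbb K^{q\times p}\to\mathbb K^k$ subspace embedding, then $$\Theta:\ G\mapsto\Upsilon\big(Q_{W_q}\,G\,R_V^{-1}Q_{V_p}^*\big)=\Upsilon\big(\mathbf W_q^*R_W\,G\,\mathbf V_p\big)$$ is a $(\varepsilon,\delta,d)$ oblivious $HS(V_p,W_q)\to\mathbb K^k$ subspace embedding.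
   Context: $M^*$ is the conjugate transpose; the inner products are $\langle v_1,v_2\rangle_V=v_1^*R_Vv_2$ and $\langle w_1,w_2\rangle_W=w_1^*R_Ww_2$. $\Pi_{V_p}:V\to V_p$ and $\Pi_{W_q}:W\to W_q$ are the orthogonal projectors. The Hilbert--Schmidt inner product on operators $V\to W$ is $\langle G_1,G_2\rangle_{HS(V,W)}=\mathrm{Tr}(G_1^*R_WG_2R_V^{-1})=\sum_i\langle G_1v_i,G_2v_i\rangle_W$ for any orthonormal basis $(v_i)$ of $V$. $HS(V_p,W_q)$ denotes the space $\mathbb K^{\dim W\times\dim V}$ of operators $V\to W$ equipped with the semi-inner product $\langle G_1,G_2\rangle_{HS(V_p,W_q)}=\langle\Pi_{W_q}G_1\Pi_{V_p},\Pi_{W_q}G_2\Pi_{V_p}\rangle_{HS(V,W)}$ and associated seminorm. $\mathbb K^{q\times p}$ carries the Frobenius inner product $\langle X,Y\rangle_F=\mathrm{Tr}(X^*Y)$. For a finite-dimensional space $Z$ over $\mathbb K$ with a (semi-)inner product, a random linear map $\Theta:Z\to\mathbb K^k$ is called a $(\varepsilon,\delta,d)$ oblivious $Z\to\mathbb K^k$ subspace embedding if for every (deterministic) subspace $Z_d\subset Z$ with $\dim Z_d=d$, $$\mathbb P\big(\forall x,y\in Z_d:\ |\langle x,y\rangle_Z-\langle\Theta(x),\Theta(y)\rangle_2|\le\varepsilon\|x\|_Z\|y\|_Z\big)\ge 1-\delta .$$ This notion is only considered for $1\le d\le\dim Z$; in particular $d\le qp$ here. *)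

theory Defs
  imports
    "HOL-Analysis.Analysis"
    "HOL-Probability.Probability"
    "Jordan_Normal_Form.Conjugate"
begin

text \<open>
  The scalar field is the reals or the complex numbers. A normed field over the reals whose norm
  comes from a finite-dimensional inner product is isometrically isomorphic to one of these two, and
  the last axiom leaves only the usual conjugation (the identity on the reals).
\<close>

class rc_field = conjugatable_field + real_normed_field + euclidean_space +
  assumes mult_conjugate: "a * conjugate a = (norm a)\<^sup>2 *\<^sub>R 1"

instance real :: rc_field
  by standard (simp add: power2_eq_square)

instance complex :: rc_field
  by standard (simp add: complex_mult_cnj cmod_power2 scaleR_conv_of_real)

text \<open>
  By polarization, the real inner product of an \<open>rc_field\<close> is the real part of
  \<open>conjugate a * b\<close>, so this is the usual real part.
\<close>

definition real_part :: "'k::rc_field \<Rightarrow> real" where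
  "real_part a = inner a 1"

lemma real_part_real [simp]: "real_part (a::real) = a"
  by (simp add: real_part_def)

lemma real_part_complex [simp]: "real_part (a::complex) = Re a"
  by (simp add: real_part_def inner_complex_def)

definition ctranspose :: "'k::rc_field^'n^'m \<Rightarrow> 'k^'m^'n" where
  "ctranspose A = map_matrix conjugate (transpose A)"

text \<open>The inner product \<open>v\<^sup>* R w\<close>.\<close>

definition ip :: "'k::rc_field^'n^'n \<Rightarrow> 'k^'n \<Rightarrow> 'k^'n \<Rightarrow> 'k" where
  "ip R v w = (\<Sum>i\<in>UNIV. conjugate (v $ i) * (R *v w) $ i)"

definition self_adjoint_pos_def :: "'k::rc_field^'n^'n \<Rightarrow> bool" where
  "self_adjoint_pos_def R \<longleftrightarrow> ctranspose R = R \<and> (\<forall>v. v \<noteq> 0 \<longrightarrow> 0 < real_part (ip R v v))"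

text \<open>
  The matrix of the projector onto the subspace \<open>S\<close> that is orthogonal for \<open>ip R\<close>; it is
  uniquely determined when \<open>R\<close> is self-adjoint positive definite.
\<close>

definition orth_projector :: "'k::rc_field^'n^'n \<Rightarrow> ('k^'n) set \<Rightarrow> 'k^'n^'n" where
  "orth_projector R S =
     (THE P. \<forall>v. P *v v \<in> S \<and> (\<forall>s\<in>S. ip R s (v - P *v v) = 0))"

definition HS_ip ::
    "'k::rc_field^'n^'n \<Rightarrow> 'k^'m^'m \<Rightarrow> 'k^'n^'m \<Rightarrow> 'k^'n^'m \<Rightarrow> 'k" where
  "HS_ip RV RW G1 G2 = trace (ctranspose G1 ** RW ** G2 ** matrix_inv RV)"

definition HS_sub_ip ::
    "'k::rc_field^'n^'n \<Rightarrow> 'k^'m^'m \<Rightarrow> ('k^'n) set \<Rightarrow> ('k^'m) set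
      \<Rightarrow> 'k^'n^'m \<Rightarrow> 'k^'n^'m \<Rightarrow> 'k" where
  "HS_sub_ip RV RW Vp Wq G1 G2 =
     HS_ip RV RW
       (orth_projector RW Wq ** G1 ** orth_projector RV Vp)
       (orth_projector RW Wq ** G2 ** orth_projector RV Vp)"

definition frobenius_ip :: "'k::rc_field^'p^'q \<Rightarrow> 'k^'p^'q \<Rightarrow> 'k" where
  "frobenius_ip X Y = trace (ctranspose X ** Y)"

definition mscale :: "'k::rc_field \<Rightarrow> 'k^'n^'m \<Rightarrow> 'k^'n^'m" where
  "mscale c A = map_matrix ((*) c) A"

lemma vector_space_mscale: "vector_space (mscale :: 'k::rc_field \<Rightarrow> 'k^'n^'m \<Rightarrow> 'k^'n^'m)"
  by standard (simp_all add: mscale_def vec_eq_iff algebra_simps)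

text \<open>
  A random linear map from \<open>Z\<close> to \<open>\<bbbK>\<^sup>k\<close>, where \<open>sc\<close> is the scalar multiplication of \<open>Z\<close>: every
  sample is linear over the scalar field and every evaluation is a random vector.
\<close>

definition random_linear_map ::
    "('k::rc_field \<Rightarrow> 'z::ab_group_add \<Rightarrow> 'z) \<Rightarrow> 'w measure \<Rightarrow> ('w \<Rightarrow> 'z \<Rightarrow> 'k^'r) \<Rightarrow> bool" where
  "random_linear_map sc M \<Theta> \<longleftrightarrow>
     (\<forall>\<omega>\<in>space M. Vector_Spaces.linear sc (*s) (\<Theta> \<omega>)) \<and>
     (\<forall>z. (\<lambda>\<omega>. \<Theta> \<omega> z) \<in> borel_measurable M)"

text \<open>
  The seminorm of a semi-inner product; the real part only serves as a coercion, since the values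
  on the diagonal are real.
\<close>

definition ip_norm :: "('z \<Rightarrow> 'z \<Rightarrow> 'k::rc_field) \<Rightarrow> 'z \<Rightarrow> real" where
  "ip_norm ipZ z = sqrt (real_part (ipZ z z))"

text \<open>
  The space \<open>Z\<close> is the type \<open>'z\<close> with scalar multiplication \<open>sc\<close> and (semi-)inner product
  \<open>ipZ\<close>; the number \<open>k\<close> is \<open>CARD('r)\<close>. The admissible range of \<open>d\<close> is part of the notion.
\<close>

definition oblivious_subspace_embedding ::
    "('k::rc_field \<Rightarrow> 'z::ab_group_add \<Rightarrow> 'z) \<Rightarrow> ('z \<Rightarrow> 'z \<Rightarrow> 'k) \<Rightarrow> real \<Rightarrow> real \<Rightarrow> nat
      \<Rightarrow> 'w measure \<Rightarrow> ('w \<Rightarrow> 'z \<Rightarrow> 'k^'r) \<Rightarrow> bool" where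
  "oblivious_subspace_embedding sc ipZ \<epsilon> \<delta> d M \<Theta> \<longleftrightarrow>
     1 \<le> d \<and> d \<le> vector_space.dim sc UNIV \<and>
     random_linear_map sc M \<Theta> \<and>
     (\<forall>Zd. module.subspace sc Zd \<and> vector_space.dim sc Zd = d \<longrightarrow>
        measure M {\<omega>\<in>space M. \<forall>x\<in>Zd. \<forall>y\<in>Zd.
            norm (ipZ x y - ip (mat 1) (\<Theta> \<omega> x) (\<Theta> \<omega> y)) \<le> \<epsilon> * ip_norm ipZ x * ip_norm ipZ y}
          \<ge> 1 - \<delta>)"

end

theory Submission
  imports Defs
begin

text \<open>
  Write \<open>V\<close>, \<open>W\<close> for the matrices of the two orthonormal bases. The map
  \<open>J G = W\<^sup>* R\<^sub>W G V\<close> extracts from \<open>G\<close> the coefficients, in these bases, of the compression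
  of \<open>G\<close> to the two subspaces. Since the projectors are \<open>V V\<^sup>* R\<^sub>V\<close> and \<open>W W\<^sup>* R\<^sub>W\<close>
  (\<open>orth_projector_span_columns\<close>), cyclicity of the trace turns the semi-inner product of
  \<open>HS(V\<^sub>p, W\<^sub>q)\<close> into the Frobenius inner product of coefficient matrices
  (\<open>HS_sub_ip_eq_frobenius_ip\<close>): \<open>J\<close> is a semi-isometry, and it maps onto all coefficient
  matrices. As \<open>R\<^sub>V\<^sup>-\<^sup>1 Q\<^sub>V\<^sup>* = V\<close>, the sketch \<open>\<Theta>\<close> is \<open>\<Upsilon> \<circ> J\<close>, so the embedding
  event of \<open>\<Theta>\<close> on a subspace \<open>Z\<close> is the embedding event of \<open>\<Upsilon>\<close> on \<open>J Z\<close>.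

  Two points need care in \<open>oblivious_subspace_embedding_pullback\<close>. Because the semi-inner
  product may be degenerate, \<open>J Z\<close> can have dimension less than \<open>d\<close>, and then nothing is known
  about \<open>J Z\<close> directly. It is enlarged to a subspace of dimension \<open>d\<close>, which exists since
  \<open>d\<close> is at most the dimension of the target, and the embedding event of the larger subspace
  is contained in that of \<open>J Z\<close>. Comparing their probabilities requires the event of \<open>J Z\<close> to be
  measurable, although it quantifies over uncountably many vectors: all samples are linear,
  hence continuous, so a countable dense set of vectors decides the event
  (\<open>sets_frobenius_embedding_event\<close>).
\<close>

section \<open>Conjugation and the conjugate transpose\<close>

text \<open>
  The field axiom only prescribes \<open>a * conjugate a\<close>; taking norms shows that conjugation is
  an isometry, and being additive it is then continuous.
\<close>

lemma norm_conjugate: "norm (conjugate a) = norm (a::'k::rc_field)"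
proof (cases "a = 0")
  case False
  have "norm a * norm (conjugate a) = norm a * norm a"
    using arg_cong[OF mult_conjugate[of a], of norm] by (simp add: norm_mult power2_eq_square)
  with False show ?thesis by simp
qed simp

lemma continuous_on_conjugate [continuous_intros]:
  assumes "continuous_on S f"
  shows "continuous_on S (\<lambda>x. conjugate (f x :: 'k::rc_field))"
proof -
  have diff: "conjugate (a - b) = conjugate a - conjugate b" for a b :: 'k
    using conjugate_dist_add[of a "- b"] by (simp add: conjugate_neg)
  have "continuous_on (f ` S) (conjugate :: 'k \<Rightarrow> 'k)"
    unfolding continuous_on_iff dist_norm by (metis diff norm_conjugate)
  then show ?thesis
    using continuous_on_compose[OF assms] by (simp add: o_def)
qed

lemma ctranspose_nth [simp]: "ctranspose A $ i $ j = conjugate (A $ j $ i)"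
  by (simp add: ctranspose_def transpose_def)

lemma ctranspose_ctranspose [simp]: "ctranspose (ctranspose A) = A"
  by (simp add: vec_eq_iff)

lemma ctranspose_mult: "ctranspose (A ** B) = ctranspose B ** ctranspose A"
  by (simp add: vec_eq_iff matrix_matrix_mult_def sum_conjugate conjugate_dist_mul mult.commute)

section \<open>Orthogonal projectors\<close>

lemma self_adjoint_pos_def_definite:
  assumes "self_adjoint_pos_def R" "ip R v v = 0"
  shows "v = 0"
  using assms by (auto simp: self_adjoint_pos_def_def real_part_def)

lemma matrix_inv_self_adjoint_pos_def:
  assumes "self_adjoint_pos_def R"
  shows "matrix_inv R ** R = mat 1" "R ** matrix_inv R = mat 1"
proof -
  have "v = 0" if "R *v v = 0" for v
    using that by (intro self_adjoint_pos_def_definite[OF assms]) (simp add: ip_def)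
  then have "\<exists>B. B ** R = mat 1"
    by (simp add: matrix_left_invertible_ker)
  then have "invertible R"
    by (simp add: invertible_left_inverse)
  then have "R ** matrix_inv R = mat 1 \<and> matrix_inv R ** R = mat 1"
    unfolding invertible_def matrix_inv_def by (rule someI_ex)
  then show "matrix_inv R ** R = mat 1" "R ** matrix_inv R = mat 1"
    by simp_all
qed

text \<open>
  Existence is the usual formula for an orthonormal basis. For uniqueness, the difference
  \<open>s\<close> of two candidate images of \<open>v\<close> lies in the subspace and is orthogonal to it, so
  \<open>ip R s s = 0\<close>.
\<close>

lemma orth_projector_span_columns:
  assumes R: "self_adjoint_pos_def R" and A: "ctranspose A ** R ** A = mat 1"
  shows "orth_projector R (vec.span (columns A)) = A ** (ctranspose A ** R)"
  unfolding orth_projector_def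
proof (rule the_equality)
  let ?S = "vec.span (columns A)" and ?P = "A ** (ctranspose A ** R)"
  have in_span: "?P *v v \<in> ?S" for v
    by (simp only: matrix_vector_mul_assoc[symmetric] matrix_vector_mult_in_columnspace_gen)
  have orth: "ip R s (v - ?P *v v) = 0" if "s \<in> ?S" for s v
    using that
  proof (induction s rule: vec.span_induct)
    case base
    show ?case
      by (rule vec.subspaceI)
        (simp_all add: ip_def conjugate_dist_add conjugate_dist_mul distrib_right sum.distrib
          mult.assoc sum_distrib_left[symmetric])
  next
    case (step s)
    then obtain j where s: "s = column j A"
      by (auto simp: columns_def)
    \<comment> \<open>the inner product with the \<open>j\<close>-th column is the \<open>j\<close>-th entry of \<open>A\<^sup>* R (v - P v)\<close>\<close>
    have "ctranspose A ** (R ** ?P) = ctranspose A ** R"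
      using A by (simp add: matrix_mul_assoc)
    then have "ctranspose A *v (R *v (v - ?P *v v)) = 0"
      by (simp add: matrix_vector_mul_assoc matrix_vector_mult_diff_distrib)
    then have "(ctranspose A *v (R *v (v - ?P *v v))) $ j = 0"
      by simp
    then show ?case
      by (simp add: s ip_def column_def matrix_vector_mult_def[of "ctranspose A"])
  qed
  show "\<forall>v. ?P *v v \<in> ?S \<and> (\<forall>s\<in>?S. ip R s (v - ?P *v v) = 0)"
    using in_span orth by blast
  fix P assume P: "\<forall>v. P *v v \<in> ?S \<and> (\<forall>s\<in>?S. ip R s (v - P *v v) = 0)"
  have "P *v v = ?P *v v" for v
  proof -
    define s where "s = P *v v - ?P *v v"
    have "s \<in> ?S"
      unfolding s_def using P in_span by (blast intro: vec.span_diff)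
    then have "ip R s (v - ?P *v v) - ip R s (v - P *v v) = 0"
      using P orth by simp
    moreover have "ip R s (v - ?P *v v) - ip R s (v - P *v v) = ip R s s"
      by (simp add: ip_def s_def matrix_vector_mult_diff_distrib sum_subtractf[symmetric]
          right_diff_distrib[symmetric])
    ultimately have "s = 0"
      using self_adjoint_pos_def_definite[OF R] by simp
    then show ?thesis
      by (simp add: s_def)
  qed
  then show "P = ?P"
    by (simp add: matrix_eq)
qed

section \<open>The isometry onto the coefficient matrices\<close>

text \<open>
  Inserting the projectors produces the factors \<open>W\<^sup>* R\<^sub>W W\<close> in the middle of the trace,
  and \<open>R\<^sub>V V\<close> and \<open>V\<^sup>*\<close> at its two ends, where the outer \<open>R\<^sub>V\<close> of the second projector
  has cancelled against the inverse of \<open>R\<^sub>V\<close>; moving \<open>R\<^sub>V V\<close> around cyclically yields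
  \<open>V\<^sup>* R\<^sub>V V\<close>. Both Gram matrices are the identity.
\<close>

lemma HS_sub_ip_eq_frobenius_ip:
  assumes RV: "self_adjoint_pos_def RV" and RW: "self_adjoint_pos_def RW"
    and VV: "ctranspose VV ** RV ** VV = mat 1" and WW: "ctranspose WW ** RW ** WW = mat 1"
  shows "HS_sub_ip RV RW (vec.span (columns VV)) (vec.span (columns WW)) G1 G2 =
    frobenius_ip (ctranspose WW ** RW ** G1 ** VV) (ctranspose WW ** RW ** G2 ** VV)"
proof -
  have sa: "ctranspose RV = RV" "ctranspose RW = RW"
    using RV RW by (simp_all add: self_adjoint_pos_def_def)
  have cancel: "ctranspose WW ** (RW ** (WW ** X)) = X" for X
    using WW by (metis matrix_mul_assoc matrix_mul_lid)
  have cancelV: "ctranspose VV ** (RV ** VV) = mat 1"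
    using VV by (simp add: matrix_mul_assoc)
  let ?Y = "ctranspose VV ** (ctranspose G1 ** (RW ** (WW ** (ctranspose WW ** (RW ** (G2 ** VV))))))"
  have "HS_sub_ip RV RW (vec.span (columns VV)) (vec.span (columns WW)) G1 G2 =
      trace ((RV ** VV) ** (?Y ** ctranspose VV))"
    by (simp add: HS_sub_ip_def HS_ip_def orth_projector_span_columns[OF RV VV]
        orth_projector_span_columns[OF RW WW] ctranspose_mult sa cancel
        matrix_inv_self_adjoint_pos_def[OF RV] flip: matrix_mul_assoc)
  also have "\<dots> = trace (?Y ** (ctranspose VV ** (RV ** VV)))"
    by (subst trace_mul_sym) (simp flip: matrix_mul_assoc)
  also have "\<dots> = frobenius_ip (ctranspose WW ** RW ** G1 ** VV) (ctranspose WW ** RW ** G2 ** VV)"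
    by (simp add: cancelV frobenius_ip_def ctranspose_mult sa flip: matrix_mul_assoc)
  finally show ?thesis .
qed

text \<open>
  The operator \<open>W X V\<^sup>* R\<^sub>V\<close> has coefficient matrix \<open>X\<close>.
\<close>

lemma surj_compression:
  fixes VV :: "'k::rc_field^'p^'n" and WW :: "'k^'q^'m"
  assumes VV: "ctranspose VV ** RV ** VV = mat 1" and WW: "ctranspose WW ** RW ** WW = mat 1"
  shows "surj (\<lambda>G. ctranspose WW ** RW ** G ** VV)"
proof (rule surjI)
  fix X
  have "ctranspose WW ** RW ** (WW ** X ** (ctranspose VV ** RV)) ** VV =
      (ctranspose WW ** RW ** WW) ** X ** (ctranspose VV ** RV ** VV)"
    by (simp add: matrix_mul_assoc)
  then show "ctranspose WW ** RW ** (WW ** X ** (ctranspose VV ** RV)) ** VV = X"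
    by (simp add: VV WW)
qed

lemma linear_mscale_mult:
  "Vector_Spaces.linear mscale mscale (\<lambda>G :: 'k::rc_field^'n^'m. A ** G ** B)"
  by (simp add: Vector_Spaces.linear_iff vector_space_mscale mscale_def vec_eq_iff
      matrix_matrix_mult_def sum_distrib_left sum_distrib_right algebra_simps sum.distrib)

text \<open>
  The dimension theory of subspaces needs a finite basis, here extracted from the matrix units.
\<close>

lemma finite_dimensional_mscale:
  "\<exists>B. finite_dimensional_vector_space (mscale :: 'k::rc_field \<Rightarrow> 'k^'n^'m \<Rightarrow> 'k^'n^'m) B"
proof -
  interpret vector_space "mscale :: 'k \<Rightarrow> 'k^'n^'m \<Rightarrow> 'k^'n^'m"
    by (rule vector_space_mscale)
  define E :: "'m \<Rightarrow> 'n \<Rightarrow> 'k^'n^'m"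
    where "E a b = (\<chi> i j. if i = a \<and> j = b then 1 else 0)" for a b
  let ?E = "range (\<lambda>(a, b). E a b)"
  have "A \<in> span ?E" for A
  proof -
    have "(\<Sum>a\<in>UNIV. \<Sum>b\<in>UNIV. (A $ a $ b) * (if i = a \<and> j = b then 1 else 0)) = A $ i $ j" for i j
    proof -
      have "(\<Sum>b\<in>UNIV. (A $ a $ b) * (if i = a \<and> j = b then 1 else 0)) =
          (if a = i then A $ a $ j else 0)" for a
        by (simp add: if_distrib[of "(*) _"] cong: if_cong)
      then show ?thesis
        by simp
    qed
    then have "A = (\<Sum>a\<in>UNIV. \<Sum>b\<in>UNIV. mscale (A $ a $ b) (E a b))"
      by (simp add: vec_eq_iff mscale_def E_def)
    moreover have "(\<Sum>a\<in>UNIV. \<Sum>b\<in>UNIV. mscale (A $ a $ b) (E a b)) \<in> span ?E"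
      by (intro span_sum span_scale span_base) auto
    ultimately show ?thesis
      by simp
  qed
  then have span_E: "span ?E = UNIV"
    by blast
  obtain B where B: "B \<subseteq> ?E" "independent B" "?E \<subseteq> span B"
    by (rule maximal_independent_subset)
  then have "span B = UNIV"
    using span_E span_mono[OF B(3)] by (auto simp: span_span)
  moreover have "finite B"
    using B(1) by (rule finite_subset) simp
  ultimately have "finite_dimensional_vector_space mscale B"
    using B(2) by unfold_locales
  then show ?thesis ..
qed

section \<open>Measurability of the embedding event\<close>

text \<open>
  By continuity the condition on all of \<open>S\<close> is equivalent to the condition on a countable
  dense subset of \<open>S\<close>, which leaves a countable intersection of measurable sets.
\<close>

lemma sets_Collect_Ball_continuous_le:
  fixes f :: "'w \<Rightarrow> 'a::{metric_space, second_countable_topology} \<Rightarrow> real"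
  assumes cont: "\<And>\<omega>. \<omega> \<in> space M \<Longrightarrow> continuous_on UNIV (f \<omega>)"
    and meas: "\<And>x. (\<lambda>\<omega>. f \<omega> x) \<in> borel_measurable M"
  shows "{\<omega>\<in>space M. \<forall>x\<in>S. f \<omega> x \<le> 0} \<in> sets M"
proof -
  obtain T where T: "countable T" "T \<subseteq> S" "S \<subseteq> closure T"
    by (rule separable)
  have "(\<forall>x\<in>S. f \<omega> x \<le> 0) \<longleftrightarrow> (\<forall>x\<in>T. f \<omega> x \<le> 0)" if "\<omega> \<in> space M" for \<omega>
  proof
    assume "\<forall>x\<in>T. f \<omega> x \<le> 0"
    then have "T \<subseteq> {x. f \<omega> x \<le> 0}"
      by blast
    moreover have "closed {x. f \<omega> x \<le> 0}"
      using cont[OF that] by (intro closed_Collect_le) simp_all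
    ultimately have "closure T \<subseteq> {x. f \<omega> x \<le> 0}"
      by (rule closure_minimal)
    with T(3) show "\<forall>x\<in>S. f \<omega> x \<le> 0"
      by blast
  qed (use T(2) in blast)
  then have "{\<omega>\<in>space M. \<forall>x\<in>S. f \<omega> x \<le> 0} = {\<omega>\<in>space M. \<forall>x\<in>T. f \<omega> x \<le> 0}"
    by blast
  also have "\<dots> \<in> sets M"
  proof (cases "T = {}")
    case False
    then have "{\<omega>\<in>space M. \<forall>x\<in>T. f \<omega> x \<le> 0} = (\<Inter>x\<in>T. {\<omega>\<in>space M. f \<omega> x \<le> 0})"
      by blast
    also have "\<dots> \<in> sets M"
      using T(1) False meas by (intro sets.countable_INT') (auto simp: borel_measurable_iff_le)
    finally show ?thesis .
  qed simp
  finally show ?thesis .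
qed

text \<open>
  Linearity over the scalar field implies linearity over the reals, and real-linear maps out
  of a Euclidean space are continuous.
\<close>

lemma continuous_on_mscale_linear:
  fixes h :: "'k::rc_field^'p^'q \<Rightarrow> 'k^'r"
  assumes "Vector_Spaces.linear mscale (*s) h"
  shows "continuous_on S h"
proof -
  interpret h: Vector_Spaces.linear mscale "(*s)" h
    by (rule assms)
  have "h (r *\<^sub>R A) = r *\<^sub>R h A" for r A
  proof -
    have "r *\<^sub>R A = mscale (of_real r) A"
      by (simp add: vec_eq_iff mscale_def) (simp add: scaleR_conv_of_real)
    then have "h (r *\<^sub>R A) = of_real r *s h A"
      by (simp add: h.scale)
    then show ?thesis
      by (simp add: vec_eq_iff) (simp add: scaleR_conv_of_real)
  qed
  then have "linear h"
    by (intro linearI) (simp_all add: h.add)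
  then show ?thesis
    by (simp add: linear_continuous_on linear_conv_bounded_linear)
qed

lemma continuous_on_frobenius_ip [continuous_intros]:
  "continuous_on S f \<Longrightarrow> continuous_on S g \<Longrightarrow> continuous_on S (\<lambda>x. frobenius_ip (f x) (g x))"
  unfolding frobenius_ip_def trace_def matrix_matrix_mult_def
  by (simp, intro continuous_intros)

lemma continuous_on_ip [continuous_intros]:
  "continuous_on S f \<Longrightarrow> continuous_on S g \<Longrightarrow> continuous_on S (\<lambda>x. ip R (f x) (g x))"
  unfolding ip_def matrix_vector_mult_def by (simp, intro continuous_intros)

text \<open>
  The two vector quantifiers range over \<open>S \<times> S\<close>, and the defect in the embedding
  inequality is jointly continuous in the pair.
\<close>

lemma sets_frobenius_embedding_event:
  fixes \<Upsilon> :: "'w \<Rightarrow> 'k::rc_field^'p^'q \<Rightarrow> 'k^'r"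
  assumes "random_linear_map mscale M \<Upsilon>"
  shows "{\<omega>\<in>space M. \<forall>x\<in>S. \<forall>y\<in>S.
      norm (frobenius_ip x y - ip (mat 1) (\<Upsilon> \<omega> x) (\<Upsilon> \<omega> y))
        \<le> \<epsilon> * ip_norm frobenius_ip x * ip_norm frobenius_ip y} \<in> sets M"
proof -
  let ?f = "\<lambda>\<omega> z. norm (frobenius_ip (fst z) (snd z) - ip (mat 1) (\<Upsilon> \<omega> (fst z)) (\<Upsilon> \<omega> (snd z)))
      - \<epsilon> * ip_norm frobenius_ip (fst z) * ip_norm frobenius_ip (snd z)"
  have "{\<omega>\<in>space M. \<forall>z\<in>S \<times> S. ?f \<omega> z \<le> 0} \<in> sets M"
  proof (rule sets_Collect_Ball_continuous_le)
    fix \<omega> assume "\<omega> \<in> space M"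
    then have cont: "continuous_on UNIV (\<Upsilon> \<omega>)"
      using assms by (intro continuous_on_mscale_linear) (simp add: random_linear_map_def)
    have "continuous_on UNIV (\<lambda>z::('k^'p^'q) \<times> ('k^'p^'q). \<Upsilon> \<omega> (fst z))"
      "continuous_on UNIV (\<lambda>z::('k^'p^'q) \<times> ('k^'p^'q). \<Upsilon> \<omega> (snd z))"
      by (auto intro!: continuous_on_compose2[OF cont] continuous_intros)
    then show "continuous_on UNIV (?f \<omega>)"
      unfolding ip_norm_def real_part_def by (intro continuous_intros)
  next
    fix z
    have meas: "(\<lambda>\<omega>. \<Upsilon> \<omega> x) \<in> borel_measurable M" for x
      using assms by (simp add: random_linear_map_def)
    have "(\<lambda>\<omega>. ip (mat 1) (\<Upsilon> \<omega> (fst z)) (\<Upsilon> \<omega> (snd z))) \<in> borel_measurable M"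
      by (rule borel_measurable_continuous_Pair[OF meas meas]) (intro continuous_intros)
    then show "(\<lambda>\<omega>. ?f \<omega> z) \<in> borel_measurable M"
      by (intro borel_measurable_diff borel_measurable_const
          measurable_compose[OF _ borel_measurable_norm])
  qed
  then show ?thesis
    by (simp add: split_paired_Ball_Sigma)
qed

section \<open>Pulling back an embedding\<close>

lemma (in finite_dimensional_vector_space) subspace_extend_to_dim:
  assumes "subspace S" "dim S \<le> d" "d \<le> dim UNIV"
  obtains T where "S \<subseteq> T" "subspace T" "dim T = d"
proof -
  obtain B where B: "B \<subseteq> S" "independent B" "S \<subseteq> span B" "card B = dim S"
    by (rule basis_exists)
  obtain C where C: "B \<subseteq> C" "independent C" "UNIV \<subseteq> span C"
    using maximal_independent_subset_extend[OF subset_UNIV B(2)] by metis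
  have "card C = dim UNIV"
    using basis_card_eq_dim[OF subset_UNIV C(3,2)] .
  then obtain D where D: "B \<subseteq> D" "D \<subseteq> C" "card D = d"
    using exists_subset_between[of B d C] B(4) C assms(2,3) finiteI_independent by metis
  show ?thesis
  proof
    show "S \<subseteq> span D"
      using B(3) span_mono[OF D(1)] by blast
    show "dim (span D) = d"
      using D(3) independent_mono[OF C(2) D(2)] by (simp add: dim_eq_card_independent)
  qed simp
qed

text \<open>
  An embedding can be pulled back along any linear surjection \<open>T\<close> that preserves the
  semi-inner products. Surjectivity bounds the dimension of the target by that of the source,
  which makes \<open>d\<close> admissible for the source.
\<close>

lemma oblivious_subspace_embedding_pullback:
  fixes sc :: "'k::rc_field \<Rightarrow> 'z::ab_group_add \<Rightarrow> 'z"
    and sc' :: "'k \<Rightarrow> 'y::ab_group_add \<Rightarrow> 'y"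
    and \<Upsilon> :: "'w \<Rightarrow> 'y \<Rightarrow> 'k^'r"
  assumes "finite_measure M"
    and "finite_dimensional_vector_space sc B" and "finite_dimensional_vector_space sc' B'"
    and lin: "Vector_Spaces.linear sc sc' T" and surj: "surj T"
    and isom: "\<And>x y. ipZ x y = ipY (T x) (T y)"
    and emb: "oblivious_subspace_embedding sc' ipY \<epsilon> \<delta> d M \<Upsilon>"
    and event: "\<And>S. {\<omega>\<in>space M. \<forall>x\<in>S. \<forall>y\<in>S. norm (ipY x y - ip (mat 1) (\<Upsilon> \<omega> x) (\<Upsilon> \<omega> y))
        \<le> \<epsilon> * ip_norm ipY x * ip_norm ipY y} \<in> sets M"
  shows "oblivious_subspace_embedding sc ipZ \<epsilon> \<delta> d M (\<lambda>\<omega> z. \<Upsilon> \<omega> (T z))"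
proof -
  interpret finite_measure M
    by fact
  interpret Z: finite_dimensional_vector_space sc B
    by fact
  interpret Y: finite_dimensional_vector_space sc' B'
    by fact
  interpret ZY: finite_dimensional_vector_space_pair sc B sc' B'
    by unfold_locales
  interpret T: Vector_Spaces.linear sc sc' T
    by fact
  let ?event = "\<lambda>S. {\<omega>\<in>space M. \<forall>x\<in>S. \<forall>y\<in>S. norm (ipY x y - ip (mat 1) (\<Upsilon> \<omega> x) (\<Upsilon> \<omega> y))
      \<le> \<epsilon> * ip_norm ipY x * ip_norm ipY y}"
  have d: "1 \<le> d" "d \<le> Y.dim UNIV" and rand: "random_linear_map sc' M \<Upsilon>"
    and prob: "\<And>S. Y.subspace S \<Longrightarrow> Y.dim S = d \<Longrightarrow> 1 - \<delta> \<le> measure M (?event S)"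
    using emb by (auto simp: oblivious_subspace_embedding_def)
  have "Y.dim UNIV \<le> Z.dim UNIV"
    using ZY.dim_image_le[OF lin, of UNIV] surj by simp
  moreover have "random_linear_map sc M (\<lambda>\<omega> z. \<Upsilon> \<omega> (T z))"
    using rand Vector_Spaces.linear_compose[OF lin, unfolded o_def]
    unfolding random_linear_map_def by blast
  moreover have "1 - \<delta> \<le> measure M {\<omega>\<in>space M. \<forall>x\<in>S. \<forall>y\<in>S.
      norm (ipZ x y - ip (mat 1) (\<Upsilon> \<omega> (T x)) (\<Upsilon> \<omega> (T y))) \<le> \<epsilon> * ip_norm ipZ x * ip_norm ipZ y}"
    if S: "Z.subspace S" "Z.dim S = d" for S
  proof -
    \<comment> \<open>\<open>T\<close> may annihilate part of \<open>S\<close>, so the image has to be enlarged to dimension \<open>d\<close>\<close>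
    have "Y.dim (T ` S) \<le> d"
      using ZY.dim_image_le[OF lin, of S] S(2) by simp
    then obtain S' where S': "T ` S \<subseteq> S'" "Y.subspace S'" "Y.dim S' = d"
      using Y.subspace_extend_to_dim[OF T.subspace_image[OF S(1)]] d(2) by metis
    have "1 - \<delta> \<le> measure M (?event S')"
      using prob S'(2,3) .
    also have "\<dots> \<le> measure M (?event (T ` S))"
      using S'(1) by (intro finite_measure_mono event) blast
    finally show ?thesis
      by (simp add: isom ip_norm_def)
  qed
  ultimately show ?thesis
    using d by (auto simp: oblivious_subspace_embedding_def)
qed

theorem proposition3p10:
  fixes RV :: "'k::rc_field^'n^'n" and RW :: "'k^'m^'m"
    and Vp :: "('k^'n) set" and Wq :: "('k^'m) set"
    and VV :: "'k^'p^'n" and WW :: "'k^'q^'m"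
    and QV :: "'k^'n^'p" and QW :: "'k^'m^'q"
    and M :: "'w measure"
    and \<Upsilon> :: "'w \<Rightarrow> 'k^'p^'q \<Rightarrow> 'k^'r"
    and \<Theta> :: "'w \<Rightarrow> 'k^'n^'m \<Rightarrow> 'k^'r"
    and \<epsilon> \<delta> :: real and d :: nat
  assumes "self_adjoint_pos_def RV" and "self_adjoint_pos_def RW"
    and "vec.subspace Vp" and "vec.subspace Wq"
    and "vec.span (columns VV) = Vp" and "vec.span (columns WW) = Wq"
    and "ctranspose VV ** RV ** VV = mat 1" and "ctranspose WW ** RW ** WW = mat 1"
    and "QV = ctranspose VV ** RV" and "QW = ctranspose WW ** RW"
    and "prob_space M"
    and "oblivious_subspace_embedding mscale frobenius_ip \<epsilon> \<delta> d M \<Upsilon>"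
    and "\<Theta> = (\<lambda>\<omega> G. \<Upsilon> \<omega> (QW ** G ** matrix_inv RV ** ctranspose QV))"
  shows "ctranspose QV ** QV = RV ** orth_projector RV Vp \<and>
         ctranspose QW ** QW = RW ** orth_projector RW Wq \<and>
         (\<forall>\<omega> G. \<Theta> \<omega> G = \<Upsilon> \<omega> (ctranspose WW ** RW ** G ** VV)) \<and>
         oblivious_subspace_embedding mscale (HS_sub_ip RV RW Vp Wq) \<epsilon> \<delta> d M \<Theta>"
proof (intro conjI allI)
  note RV = assms(1) and RW = assms(2) and VV = assms(7) and WW = assms(8)
  note span = assms(5,6)[symmetric]
  have sa: "ctranspose RV = RV" "ctranspose RW = RW"
    using RV RW by (simp_all add: self_adjoint_pos_def_def)
  show "ctranspose QV ** QV = RV ** orth_projector RV Vp"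
    by (simp add: span orth_projector_span_columns[OF RV VV] assms(9) ctranspose_mult sa
        flip: matrix_mul_assoc)
  show "ctranspose QW ** QW = RW ** orth_projector RW Wq"
    by (simp add: span orth_projector_span_columns[OF RW WW] assms(10) ctranspose_mult sa
        flip: matrix_mul_assoc)
  have "matrix_inv RV ** ctranspose QV = VV"
    by (simp add: assms(9) ctranspose_mult sa matrix_mul_assoc matrix_inv_self_adjoint_pos_def[OF RV])
  then show eq: "\<Theta> \<omega> G = \<Upsilon> \<omega> (ctranspose WW ** RW ** G ** VV)" for \<omega> G
    by (simp add: assms(10,13) flip: matrix_mul_assoc)
  interpret prob_space M
    by fact
  obtain B :: "('k^'n^'m) set" and B' :: "('k^'p^'q) set"
    where fin: "finite_dimensional_vector_space mscale B" "finite_dimensional_vector_space mscale B'"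
    using finite_dimensional_mscale by metis
  have rand: "random_linear_map mscale M \<Upsilon>"
    using assms(12) by (simp add: oblivious_subspace_embedding_def)
  have isom: "HS_sub_ip RV RW Vp Wq G1 G2 =
      frobenius_ip (ctranspose WW ** RW ** G1 ** VV) (ctranspose WW ** RW ** G2 ** VV)" for G1 G2
    unfolding span by (rule HS_sub_ip_eq_frobenius_ip[OF RV RW VV WW])
  have "oblivious_subspace_embedding mscale (HS_sub_ip RV RW Vp Wq) \<epsilon> \<delta> d M
      (\<lambda>\<omega> G. \<Upsilon> \<omega> (ctranspose WW ** RW ** G ** VV))"
    by (rule oblivious_subspace_embedding_pullback[OF finite_measure_axioms fin linear_mscale_mult
          surj_compression[OF VV WW] isom assms(12) sets_frobenius_embedding_event[OF rand]])
  then show "oblivious_subspace_embedding mscale (HS_sub_ip RV RW Vp Wq) \<epsilon> \<delta> d M \<Theta>"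
    by (simp add: eq[abs_def])
qed

end
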